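(* Consider the extended CDT problem $$\mathrm{(P_{CDT})}\qquad z^*=\min\{\, x^\top Q_0x+2q_0^\top x : x\in\mathbb{R}^n,\ \|x\|^2\le1,\ \|Ax-a\|^2\le1,\ Bx\le b\,\},$$ whose feasible set is assumed non-empty. Let $Q_0^+:=Q_0-\lambda_{\min}(Q_0)I_n$ and let $M=[\,Q_0^+\,|\,A^\top\,]^\top$ (the $(n+\ell)\times n$ matrix obtained by stacking $Q_0^+$ on top of $A$). Suppose that $$\ker(M)\cap\{v\in\mathbb{R}^n: Bv\le 0\}\cap\{v\in\mathbb{R}^n: q_0^\top v\le0\}\neq\{0\}.$$ Then $z^*_{\rm LD}=z^*_{\rm COP}=z^*$, where $z^*_{\rm LD}$ and $z^*_{\rm COP}$ are the optimal values of the Lagrangian relaxation and of the copositive relaxation of $\mathrm{(P_{CDT})}$.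
   Context: Data: $Q_0$ is a real symmetric $n\times n$ matrix with smallest eigenvalue $\lambda_{\min}(Q_0)$, $A$ is a real $\ell\times n$ matrix, $B$ is a real $p\times n$ matrix, $a\in\mathbb{R}^\ell$, $b\in\mathbb{R}^p$, $q_0\in\mathbb{R}^n$; norms are Euclidean and vector inequalities are componentwise; $I_n$ is the identity. For $y=(s,x)\in\mathbb{R}^p\times\mathbb{R}^n$ put $\bar f_0(y)=x^\top Q_0x+2q_0^\top x$, $\bar f_1(y)=\|x\|^2-1$, $\bar f_2(y)=\|Ax-a\|^2-1$, $\bar f_3(y)=\|Bx+s-b\|^2$. Lagrangian: for $u\in\mathbb{R}^3_+$, $v\in\mathbb{R}^p$, let $L(y;u,v)=\bar f_0(y)+\sum_{i=1}^3u_i\bar f_i(y)-v^\top s$. Lagrangian relaxation value: $z^*_{\rm LD}=\sup\{\Theta(u,v):(u,v)\in\mathbb{R}^3_+\times\mathbb{R}^p_+\}$ with $\Theta(u,v)=\inf\{L(y;u,v): y\in\mathbb{R}^{p+n}\}$. Shor matrix: for a quadratic function $q(y)=y^\top Hy-2d^\top y+\gamma$ on $\mathbb{R}^N$ ($H$ symmetric), $M(q)=\begin{bmatrix}\gamma&-d^\top\\-d&H\end{bmatrix}$. $J_0$ denotes the matrix of order $p+n+1$ whose $(1,1)$ entry is $1$ and all of whose other entries are $0$. A symmetric matrix $Q$ of order $p+n+1$ is $\Upsilon$-copositive, with $\Upsilon=\mathbb{R}^{p+1}_+\times\mathbb{R}^n$, if $w^\top Qw\ge0$ for all $w\in\Upsilon$.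 Copositive relaxation value: $z^*_{\rm COP}=\sup\{\mu : (\mu,u)\in\mathbb{R}\times\mathbb{R}^3_+,\ M(L(\cdot;u,0))-\mu J_0\ \text{is}\ \Upsilon\text{-copositive}\}$. *)

theory Defs
  imports "HOL-Analysis.Analysis"
begin

definition symmetric_matrix :: "real^'m^'m \<Rightarrow> bool" where
  "symmetric_matrix Q \<longleftrightarrow> transpose Q = Q"

definition lambda_min :: "real^'n^'n \<Rightarrow> real" where
  "lambda_min Q = (LEAST c. \<exists>v. v \<noteq> 0 \<and> Q *v v = c *\<^sub>R v)"

definition ker :: "real^'n^'k \<Rightarrow> (real^'n) set" where
  "ker M = {v. M *v v = 0}"

definition stack_rows :: "real^'n^'k \<Rightarrow> real^'n^'l \<Rightarrow> real^'n^('k + 'l)" where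
  "stack_rows P A = (\<chi> i. case i of Inl k \<Rightarrow> P $ k | Inr l \<Rightarrow> A $ l)"

(* The order on real^'p is the componentwise one. *)

definition cdt_objective :: "real^'n^'n \<Rightarrow> real^'n \<Rightarrow> real^'n \<Rightarrow> real" where
  "cdt_objective Q\<^sub>0 q\<^sub>0 x = x \<bullet> (Q\<^sub>0 *v x) + 2 * (q\<^sub>0 \<bullet> x)"

definition cdt_feasible ::
  "real^'n^'l \<Rightarrow> real^'l \<Rightarrow> real^'n^'p \<Rightarrow> real^'p \<Rightarrow> (real^'n) set" where
  "cdt_feasible A a B b = {x. (norm x)\<^sup>2 \<le> 1 \<and> (norm (A *v x - a))\<^sup>2 \<le> 1 \<and> B *v x \<le> b}"

(* All optimal values are extended reals: the dual function may be -\<infinity>, and the supremum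
   over an empty set is -\<infinity>.  For a non-empty feasible set the infimum below is a minimum;
   see cdt_value_attained. *)
definition cdt_value ::
  "real^'n^'n \<Rightarrow> real^'n \<Rightarrow> real^'n^'l \<Rightarrow> real^'l \<Rightarrow> real^'n^'p \<Rightarrow> real^'p \<Rightarrow> ereal" where
  "cdt_value Q\<^sub>0 q\<^sub>0 A a B b =
     (INF x\<in>cdt_feasible A a B b. ereal (cdt_objective Q\<^sub>0 q\<^sub>0 x))"

(* A point y = (s, x) of R^(p+n) is a vector indexed by 'p + 'n. *)

definition s_part :: "real^('p::finite + 'n::finite) \<Rightarrow> real^'p" where
  "s_part y = (\<chi> i. y $ Inl i)"

definition x_part :: "real^('p::finite + 'n::finite) \<Rightarrow> real^'n" where
  "x_part y = (\<chi> j. y $ Inr j)"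

definition f0_bar :: "real^'n^'n \<Rightarrow> real^'n \<Rightarrow> real^('p::finite + 'n::finite) \<Rightarrow> real" where
  "f0_bar Q\<^sub>0 q\<^sub>0 y = x_part y \<bullet> (Q\<^sub>0 *v x_part y) + 2 * (q\<^sub>0 \<bullet> x_part y)"

definition f1_bar :: "real^('p::finite + 'n::finite) \<Rightarrow> real" where
  "f1_bar y = (norm (x_part y))\<^sup>2 - 1"

definition f2_bar :: "real^'n^'l \<Rightarrow> real^'l \<Rightarrow> real^('p::finite + 'n::finite) \<Rightarrow> real" where
  "f2_bar A a y = (norm (A *v x_part y - a))\<^sup>2 - 1"

definition f3_bar :: "real^'n^'p \<Rightarrow> real^'p \<Rightarrow> real^('p::finite + 'n::finite) \<Rightarrow> real" where
  "f3_bar B b y = (norm (B *v x_part y + s_part y - b))\<^sup>2"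

definition lagrangian ::
  "real^'n^'n \<Rightarrow> real^'n \<Rightarrow> real^'n^'l \<Rightarrow> real^'l \<Rightarrow> real^'n^'p \<Rightarrow> real^'p \<Rightarrow>
   real^3 \<Rightarrow> real^'p \<Rightarrow> real^('p::finite + 'n::finite) \<Rightarrow> real" where
  "lagrangian Q\<^sub>0 q\<^sub>0 A a B b u v y =
     f0_bar Q\<^sub>0 q\<^sub>0 y
     + (u $ 1 * f1_bar y + u $ 2 * f2_bar A a y + u $ 3 * f3_bar B b y)
     - v \<bullet> s_part y"

definition dual_fun ::
  "real^'n^'n \<Rightarrow> real^'n \<Rightarrow> real^'n^'l \<Rightarrow> real^'l \<Rightarrow> real^'n^'p \<Rightarrow> real^'p \<Rightarrow>
   real^3 \<Rightarrow> real^'p \<Rightarrow> ereal" where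
  "dual_fun Q\<^sub>0 q\<^sub>0 A a B b u v = (INF y. ereal (lagrangian Q\<^sub>0 q\<^sub>0 A a B b u v y))"

definition lagrangian_value ::
  "real^'n^'n \<Rightarrow> real^'n \<Rightarrow> real^'n^'l \<Rightarrow> real^'l \<Rightarrow> real^'n^'p \<Rightarrow> real^'p \<Rightarrow> ereal" where
  "lagrangian_value Q\<^sub>0 q\<^sub>0 A a B b =
     Sup {dual_fun Q\<^sub>0 q\<^sub>0 A a B b u v | u v. 0 \<le> u \<and> 0 \<le> v}"

(* Matrices of order N + 1 are indexed by 'm option, where None is the leading index. *)

definition quadratic_fun ::
  "real^'m^'m \<Rightarrow> real^'m \<Rightarrow> real \<Rightarrow> real^'m \<Rightarrow> real" where
  "quadratic_fun H d \<gamma> y = y \<bullet> (H *v y) - 2 * (d \<bullet> y) + \<gamma>"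

definition shor_block ::
  "real^'m^'m \<Rightarrow> real^'m \<Rightarrow> real \<Rightarrow> real^('m option)^('m option)" where
  "shor_block H d \<gamma> =
     (\<chi> i j. case i of
        None \<Rightarrow> (case j of None \<Rightarrow> \<gamma> | Some l \<Rightarrow> - (d $ l))
      | Some k \<Rightarrow> (case j of None \<Rightarrow> - (d $ k) | Some l \<Rightarrow> H $ k $ l))"

(* The matrix M(q) of a quadratic function q.  The description is unique (shor_matrix_eq), and
   the value is unspecified when q is not quadratic. *)
definition shor_matrix :: "(real^'m \<Rightarrow> real) \<Rightarrow> real^('m option)^('m option)" where
  "shor_matrix q =
     (THE M. \<exists>H d \<gamma>. symmetric_matrix H \<and> q = quadratic_fun H d \<gamma> \<and> M = shor_block H d \<gamma>)"

definition J0 :: "real^('m::finite option)^('m option)" where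
  "J0 = (\<chi> i j. if i = None \<and> j = None then 1 else 0)"

definition Upsilon :: "(real^(('p::finite + 'n::finite) option)) set" where
  "Upsilon = {w. 0 \<le> w $ None \<and> (\<forall>i. 0 \<le> w $ Some (Inl i))}"

definition copositive_on :: "(real^'m) set \<Rightarrow> real^'m^'m \<Rightarrow> bool" where
  "copositive_on K Q \<longleftrightarrow> symmetric_matrix Q \<and> (\<forall>w\<in>K. 0 \<le> w \<bullet> (Q *v w))"

definition copositive_value ::
  "real^'n^'n \<Rightarrow> real^'n \<Rightarrow> real^'n^'l \<Rightarrow> real^'l \<Rightarrow> real^'n^'p \<Rightarrow> real^'p \<Rightarrow> ereal" where
  "copositive_value Q\<^sub>0 q\<^sub>0 A a B b =
     Sup {ereal \<mu> | \<mu> u. 0 \<le> u \<and>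
       copositive_on Upsilon
         (shor_matrix (lagrangian Q\<^sub>0 q\<^sub>0 A a B b u 0) - \<mu> *\<^sub>R J0)}"

lemma symmetric_inner:
  assumes "symmetric_matrix Q"
  shows "x \<bullet> (Q *v y) = y \<bullet> (Q *v x)"
proof -
  have "x \<bullet> (Q *v y) = (transpose Q *v x) \<bullet> y"
    by (simp only: dot_lmul_matrix transpose_matrix_vector)
  then show ?thesis using assms by (simp only: symmetric_matrix_def inner_commute)
qed

lemma quadratic_fun_inject:
  fixes H H' :: "real^'m^'m"
  assumes H: "symmetric_matrix H" and H': "symmetric_matrix H'"
    and eq: "quadratic_fun H d \<gamma> = quadratic_fun H' d' \<gamma>'"
  shows "H = H'" and "d = d'" and "\<gamma> = \<gamma>'"
proof -
  have q: "y \<bullet> (H *v y) - 2 * (d \<bullet> y) + \<gamma> = y \<bullet> (H' *v y) - 2 * (d' \<bullet> y) + \<gamma>'" for y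
    using fun_cong[OF eq, of y] by (simp add: quadratic_fun_def)
  show g: "\<gamma> = \<gamma>'" using q[of 0] by simp
  have neg: "M *v (- y) = - (M *v y)" for M :: "real^'m^'m" and y
    using matrix_vector_mult_diff_distrib[of M 0 y] by simp
  have dy: "d \<bullet> y = d' \<bullet> y" for y
    using q[of y] q[of "- y"] by (simp add: neg)
  show d: "d = d'" using dy vector_eq_rdot[of d d'] by blast
  have h: "y \<bullet> (H *v y) = y \<bullet> (H' *v y)" for y using q[of y] by (simp add: g d)
  have "\<forall>x. x \<bullet> (H *v y) = x \<bullet> (H' *v y)" for y
  proof
    fix x
    show "x \<bullet> (H *v y) = x \<bullet> (H' *v y)"
      using h[of "x + y"] h[of x] h[of y]
        symmetric_inner[OF H, of x y] symmetric_inner[OF H', of x y]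
      by (simp add: matrix_vector_right_distrib inner_add_left inner_add_right)
  qed
  then have "H *v y = H' *v y" for y by (simp only: vector_eq_ldot)
  then show "H = H'" by (simp add: matrix_eq)
qed

lemma shor_matrix_eq:
  assumes "symmetric_matrix H"
  shows "shor_matrix (quadratic_fun H d \<gamma>) = shor_block H d \<gamma>"
  unfolding shor_matrix_def
proof (rule the_equality)
  show "\<exists>H' d' \<gamma>'. symmetric_matrix H' \<and> quadratic_fun H d \<gamma> = quadratic_fun H' d' \<gamma>' \<and>
          shor_block H d \<gamma> = shor_block H' d' \<gamma>'"
    using assms by blast
next
  fix M
  assume "\<exists>H' d' \<gamma>'. symmetric_matrix H' \<and> quadratic_fun H d \<gamma> = quadratic_fun H' d' \<gamma>' \<and>
          M = shor_block H' d' \<gamma>'"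
  then obtain H' d' \<gamma>' where H': "symmetric_matrix H'"
    and eq: "quadratic_fun H d \<gamma> = quadratic_fun H' d' \<gamma>'" and M: "M = shor_block H' d' \<gamma>'"
    by blast
  show "M = shor_block H d \<gamma>"
    unfolding M using quadratic_fun_inject[OF assms H' eq] by simp
qed

lemma compact_cdt_feasible:
  fixes A :: "real^'n^'l" and B :: "real^'n^'p"
  shows "compact (cdt_feasible A a B b)"
proof -
  have lin: "continuous_on UNIV (\<lambda>x. M *v x)" for M :: "real^'i^'j"
    by (simp add: linear_continuous_on linear_conv_bounded_linear)
  have "closed {x :: real^'n. (norm x)\<^sup>2 \<le> 1}"
    by (intro closed_Collect_le continuous_intros)
  moreover have "closed {x. (norm (A *v x - a))\<^sup>2 \<le> 1}"
    by (intro closed_Collect_le continuous_intros lin)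
  moreover have "closed {x. B *v x \<le> b}"
    unfolding less_eq_vec_def
    by (intro closed_Collect_all closed_Collect_le continuous_intros
        continuous_on_component lin)
  moreover have "cdt_feasible A a B b =
      {x. (norm x)\<^sup>2 \<le> 1} \<inter> {x. (norm (A *v x - a))\<^sup>2 \<le> 1} \<inter> {x. B *v x \<le> b}"
    by (auto simp: cdt_feasible_def)
  ultimately have "closed (cdt_feasible A a B b)" by (simp add: closed_Int)
  moreover have "bounded (cdt_feasible A a B b)"
    by (rule boundedI[of _ 1]) (auto simp: cdt_feasible_def power_le_one_iff)
  ultimately show ?thesis by (simp add: compact_eq_bounded_closed)
qed

lemma cdt_value_attained:
  assumes "cdt_feasible A a B b \<noteq> {}"
  shows "\<exists>x\<in>cdt_feasible A a B b.
           cdt_value Q\<^sub>0 q\<^sub>0 A a B b = ereal (cdt_objective Q\<^sub>0 q\<^sub>0 x) \<and>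
           (\<forall>y\<in>cdt_feasible A a B b. cdt_objective Q\<^sub>0 q\<^sub>0 x \<le> cdt_objective Q\<^sub>0 q\<^sub>0 y)"
proof -
  have "continuous_on (cdt_feasible A a B b) (\<lambda>x. Q\<^sub>0 *v x)"
    by (simp add: linear_continuous_on linear_conv_bounded_linear)
  then have "continuous_on (cdt_feasible A a B b) (cdt_objective Q\<^sub>0 q\<^sub>0)"
    unfolding cdt_objective_def by (intro continuous_intros)
  from continuous_attains_inf[OF compact_cdt_feasible assms this]
  obtain x where x: "x \<in> cdt_feasible A a B b"
    and le: "\<forall>y\<in>cdt_feasible A a B b. cdt_objective Q\<^sub>0 q\<^sub>0 x \<le> cdt_objective Q\<^sub>0 q\<^sub>0 y" by blast
  have "cdt_value Q\<^sub>0 q\<^sub>0 A a B b = ereal (cdt_objective Q\<^sub>0 q\<^sub>0 x)"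
    unfolding cdt_value_def using x le
    by (intro antisym INF_lower INF_greatest) auto
  with x le show ?thesis by blast
qed

(* For symmetric Q the LEAST in lambda_min exists: it is the minimum of the Rayleigh quotient. *)
lemma lambda_min_eigenvalue:
  fixes Q :: "real^'n^'n"
  assumes "symmetric_matrix Q"
  shows "\<exists>v. v \<noteq> 0 \<and> Q *v v = lambda_min Q *\<^sub>R v"
    and "v \<noteq> 0 \<Longrightarrow> Q *v v = c *\<^sub>R v \<Longrightarrow> lambda_min Q \<le> c"
    and "lambda_min Q * (x \<bullet> x) \<le> x \<bullet> (Q *v x)"
proof -
  have "continuous_on (sphere 0 1) (\<lambda>x. Q *v x)"
    by (simp add: linear_continuous_on linear_conv_bounded_linear)
  then have "continuous_on (sphere 0 1) (\<lambda>x. x \<bullet> (Q *v x))"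
    by (intro continuous_intros)
  moreover have "sphere (0::real^'n) 1 \<noteq> {}" by simp
  ultimately have "\<exists>v\<in>sphere 0 1. \<forall>x\<in>sphere 0 1. v \<bullet> (Q *v v) \<le> x \<bullet> (Q *v x)"
    using continuous_attains_inf[OF compact_sphere] by blast
  then obtain v0 where v0: "norm v0 = 1"
    and min: "\<And>x. norm x = 1 \<Longrightarrow> v0 \<bullet> (Q *v v0) \<le> x \<bullet> (Q *v x)"
    by auto
  define m where "m = v0 \<bullet> (Q *v v0)"
  have ray: "m * (x \<bullet> x) \<le> x \<bullet> (Q *v x)" for x
  proof (cases "x = 0")
    case False
    define z where "z = (1 / norm x) *\<^sub>R x"
    have "norm z = 1" using False by (simp add: z_def)
    then have "m \<le> z \<bullet> (Q *v z)" using min m_def by simp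
    then have "m \<le> (x \<bullet> (Q *v x)) / (x \<bullet> x)"
      by (simp add: z_def matrix_vector_mult_scaleR power2_norm_eq_inner[symmetric] power2_eq_square)
    then show ?thesis using False by (simp add: field_simps)
  qed simp
  define g where "g = Q *v v0 - m *\<^sub>R v0"
  define P where "P w = w \<bullet> (Q *v w) - m * (w \<bullet> w)" for w
  have P0: "P w \<ge> 0" for w using ray[of w] by (simp add: P_def)
  have v01: "v0 \<bullet> v0 = 1" using v0 by (simp add: norm_eq_1)
  have "P (v0 + t *\<^sub>R g) = 2 * t * (g \<bullet> g) + t\<^sup>2 * P g" for t
  proof -
    have sym: "v0 \<bullet> (Q *v g) = g \<bullet> (Q *v v0)" by (rule symmetric_inner[OF assms])
    have gg: "g \<bullet> (Q *v v0) = g \<bullet> g + m * (g \<bullet> v0)"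
      by (subst (2) g_def) (simp add: inner_diff_right)
    show ?thesis
      unfolding P_def
      by (simp add: matrix_vector_mult_scaleR v01 sym gg m_def[symmetric]
          inner_commute[of v0 g] power2_eq_square algebra_simps)
  qed
  then have quad: "0 \<le> 2 * t * (g \<bullet> g) + t\<^sup>2 * P g" for t
    using P0[of "v0 + t *\<^sub>R g"] by simp
  have "g \<bullet> g = 0"
  proof (rule ccontr)
    assume "g \<bullet> g \<noteq> 0"
    then have gp: "g \<bullet> g > 0" by (simp add: less_le)
    define r where "r = (g \<bullet> g) / (P g + 1)"
    have rp: "r > 0" using gp P0[of g] by (simp add: r_def)
    have "r * (P g + 1) = g \<bullet> g" using P0[of g] by (simp add: r_def)
    then have "r * P g = g \<bullet> g - r" by (simp add: algebra_simps)
    then have "r * (r * P g) = r * (g \<bullet> g - r)" by simp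
    then have "r\<^sup>2 * P g = r * (g \<bullet> g) - r * r" by (simp add: power2_eq_square algebra_simps)
    moreover have "r * (g \<bullet> g) > 0" "r * r > 0" using rp gp by simp_all
    ultimately show False using quad[of "- r"] by simp
  qed
  then have eig: "Q *v v0 = m *\<^sub>R v0" by (simp add: g_def)
  have v0n: "v0 \<noteq> 0" using v0 by auto
  have low: "m \<le> c" if "v \<noteq> 0" "Q *v v = c *\<^sub>R v" for v c
    using ray[of v] that by simp
  have lam: "lambda_min Q = m"
    unfolding lambda_min_def by (rule Least_equality) (use eig v0n low in blast)+
  show "\<exists>v. v \<noteq> 0 \<and> Q *v v = lambda_min Q *\<^sub>R v" using eig v0n lam by blast
  show "v \<noteq> 0 \<Longrightarrow> Q *v v = c *\<^sub>R v \<Longrightarrow> lambda_min Q \<le> c" using low lam by simp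
  show "lambda_min Q * (x \<bullet> x) \<le> x \<bullet> (Q *v x)" using ray lam by simp
qed

end

theory Submission
  imports Defs
begin

text \<open>
  By homogenisation, \<open>M(q) - \<mu> J\<^sub>0\<close> is copositive on \<open>\<Upsilon>\<close> if and only if \<open>q \<ge> \<mu>\<close> wherever the
  slack part \<open>s\<close> is nonnegative. This gives both weak inequalities, Lagrangian value \<open>\<le>\<close>
  copositive value \<open>\<le>\<close> optimal value.

  For the converse, replace the objective by the convex function
  \<open>h(x) = f(x) + \<sigma> (\<parallel>x\<parallel>\<^sup>2 - 1)\<close> with \<open>\<sigma> = max 0 (- \<lambda>\<^sub>m\<^sub>i\<^sub>n(Q\<^sub>0))\<close>. If \<open>\<lambda>\<^sub>m\<^sub>i\<^sub>n(Q\<^sub>0) < 0\<close>, moving a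
  feasible point along a nonzero vector of the given intersection until it reaches the unit sphere
  keeps it feasible and does not increase \<open>h\<close>; as \<open>h = f\<close> on the sphere, \<open>h\<close> and \<open>f\<close> have the same
  minimum. Convex duality then applies, and the shift \<open>\<sigma>\<close> is absorbed in the first multiplier.
\<close>

section \<open>Quadratic functions and the Lagrangian\<close>

text \<open>\<open>shor_matrix\<close> has a specified value only on functions of this form. Closure
  rules certify the Lagrangian as quadratic without writing out its coefficients.\<close>

definition is_quadratic :: "(real^'m \<Rightarrow> real) \<Rightarrow> bool" where
  "is_quadratic q \<longleftrightarrow> (\<exists>H d \<gamma>. symmetric_matrix H \<and> q = quadratic_fun H d \<gamma>)"

lemma symmetric_matrix_scaleR: "symmetric_matrix H \<Longrightarrow> symmetric_matrix (c *\<^sub>R H)"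
  by (simp add: symmetric_matrix_def transpose_def vec_eq_iff)

lemma symmetric_matrix_add:
  "symmetric_matrix H \<Longrightarrow> symmetric_matrix K \<Longrightarrow> symmetric_matrix (H + K)"
  by (simp add: symmetric_matrix_def transpose_def vec_eq_iff)

lemma is_quadratic_add:
  assumes "is_quadratic q" "is_quadratic r"
  shows "is_quadratic (\<lambda>y. q y + r y)"
proof -
  obtain H d \<gamma> where H: "symmetric_matrix H" and q: "q = quadratic_fun H d \<gamma>"
    using assms(1) by (auto simp: is_quadratic_def)
  obtain K e \<delta> where K: "symmetric_matrix K" and r: "r = quadratic_fun K e \<delta>"
    using assms(2) by (auto simp: is_quadratic_def)
  have "(\<lambda>y. q y + r y) = quadratic_fun (H + K) (d + e) (\<gamma> + \<delta>)"
    by (simp add: q r quadratic_fun_def fun_eq_iff matrix_vector_mult_add_rdistrib algebra_simps)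
  then show ?thesis
    using symmetric_matrix_add[OF H K] by (auto simp: is_quadratic_def)
qed

lemma is_quadratic_cmult:
  assumes "is_quadratic q"
  shows "is_quadratic (\<lambda>y. c * q y)"
proof -
  obtain H d \<gamma> where H: "symmetric_matrix H" and q: "q = quadratic_fun H d \<gamma>"
    using assms by (auto simp: is_quadratic_def)
  have "(\<lambda>y. c * q y) = quadratic_fun (c *\<^sub>R H) (c *\<^sub>R d) (c * \<gamma>)"
    by (simp add: q quadratic_fun_def fun_eq_iff scaleR_matrix_vector_assoc[symmetric] algebra_simps)
  then show ?thesis
    using symmetric_matrix_scaleR[OF H] by (auto simp: is_quadratic_def)
qed

lemma is_quadratic_const: "is_quadratic (\<lambda>y :: real^'m. c)"
proof -
  have "symmetric_matrix (0 :: real^'m^'m)"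
    by (simp add: symmetric_matrix_def transpose_def vec_eq_iff)
  moreover have "(\<lambda>y :: real^'m. c) = quadratic_fun (0 :: real^'m^'m) 0 c"
    by (simp add: quadratic_fun_def fun_eq_iff)
  ultimately show ?thesis by (auto simp: is_quadratic_def)
qed

lemma is_quadratic_linear:
  fixes f :: "real^'m \<Rightarrow> real"
  assumes "linear f"
  shows "is_quadratic f"
proof -
  have "f y = adjoint f 1 \<bullet> y" for y
    using adjoint_works[OF assms, of y 1] by (simp add: inner_commute)
  \<comment> \<open>The factor -1/2 compensates the \<open>- 2 * (d \<bullet> y)\<close> in
    \<open>quadratic_fun\<close>.\<close>
  then have "f = quadratic_fun 0 (- (1/2) *\<^sub>R adjoint f 1) 0"
    by (simp add: quadratic_fun_def fun_eq_iff)
  moreover have "symmetric_matrix (0 :: real^'m^'m)"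
    by (simp add: symmetric_matrix_def transpose_def vec_eq_iff)
  ultimately show ?thesis by (metis is_quadratic_def)
qed

lemma is_quadratic_inner:
  fixes f g :: "real^'m \<Rightarrow> real^'k"
  assumes "linear f" "linear g"
  shows "is_quadratic (\<lambda>y. f y \<bullet> g y)"
proof -
  define F G where "F = matrix f" and "G = matrix g"
  \<comment> \<open>\<open>transpose F ** G\<close> already represents the form but need not be
    symmetric; averaging with its transpose keeps the form.\<close>
  define H where "H = (1/2) *\<^sub>R (transpose F ** G + transpose G ** F)"
  have f: "f y = F *v y" and g: "g y = G *v y" for y
    using assms by (simp_all add: F_def G_def)
  have "y \<bullet> (H *v y) = f y \<bullet> g y" for y
  proof -
    have "y \<bullet> (transpose F *v (G *v y)) = (F *v y) \<bullet> (G *v y)"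
      by (metis dot_lmul_matrix transpose_matrix_vector inner_commute)
    moreover have "y \<bullet> (transpose G *v (F *v y)) = (F *v y) \<bullet> (G *v y)"
      by (metis dot_lmul_matrix transpose_matrix_vector inner_commute)
    ultimately show ?thesis
      by (simp add: H_def f g scaleR_matrix_vector_assoc[symmetric] inner_add_right
          matrix_vector_mult_add_rdistrib matrix_vector_mul_assoc[symmetric])
  qed
  then have "(\<lambda>y. f y \<bullet> g y) = quadratic_fun H 0 0"
    by (simp add: quadratic_fun_def fun_eq_iff)
  moreover have "symmetric_matrix H"
  proof -
    have "transpose (transpose F ** G + transpose G ** F) =
        transpose (transpose F ** G) + transpose (transpose G ** F)"
      by (simp add: transpose_def vec_eq_iff)
    then have "symmetric_matrix (transpose F ** G + transpose G ** F)"
      by (simp add: symmetric_matrix_def matrix_transpose_mul add.commute)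
    then show ?thesis unfolding H_def by (rule symmetric_matrix_scaleR)
  qed
  ultimately show ?thesis by (auto simp: is_quadratic_def)
qed

lemma is_quadratic_norm_affine:
  fixes f :: "real^'m \<Rightarrow> real^'k"
  assumes "linear f"
  shows "is_quadratic (\<lambda>y. (norm (f y - c))\<^sup>2)"
proof -
  have "linear (\<lambda>y. c \<bullet> f y)"
    using linear_compose[OF assms, of "\<lambda>z. c \<bullet> z"]
    by (simp add: o_def bounded_linear.linear bounded_linear_inner_right)
  then have "is_quadratic (\<lambda>y. (f y \<bullet> f y + (- 2) * (c \<bullet> f y)) + c \<bullet> c)"
    by (intro is_quadratic_add is_quadratic_cmult is_quadratic_const is_quadratic_inner
        is_quadratic_linear assms)
  moreover have "(\<lambda>y. (norm (f y - c))\<^sup>2) = (\<lambda>y. (f y \<bullet> f y + (- 2) * (c \<bullet> f y)) + c \<bullet> c)"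
    by (simp add: fun_eq_iff power2_norm_eq_inner inner_diff_left inner_diff_right inner_commute)
  ultimately show ?thesis by simp
qed

lemma linear_s_part: "linear s_part"
  by (rule linearI) (simp_all add: s_part_def vec_eq_iff)

lemma linear_x_part: "linear x_part"
  by (rule linearI) (simp_all add: x_part_def vec_eq_iff)

lemma linear_mult_x_part: "linear (\<lambda>y. M *v x_part y)"
  using linear_compose[OF linear_x_part matrix_vector_mul_linear[of M]] by (simp add: o_def)

lemma is_quadratic_lagrangian:
  "is_quadratic (lagrangian Q\<^sub>0 q\<^sub>0 A a B b u v)"
proof -
  have inner: "linear (\<lambda>y. c \<bullet> f y)" if "linear f" for c :: "real^'k" and f :: "real^'m \<Rightarrow> real^'k"
    using linear_compose[OF that, of "\<lambda>z. c \<bullet> z"]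
    by (simp add: o_def bounded_linear.linear bounded_linear_inner_right)
  have x: "is_quadratic (\<lambda>y. (norm (x_part y - 0))\<^sup>2)"
    by (intro is_quadratic_norm_affine linear_x_part)
  have A: "is_quadratic (\<lambda>y. (norm (A *v x_part y - a))\<^sup>2)"
    by (intro is_quadratic_norm_affine linear_mult_x_part)
  have B: "is_quadratic (\<lambda>y. (norm (B *v x_part y + s_part y - b))\<^sup>2)"
    by (intro is_quadratic_norm_affine linear_compose_add linear_mult_x_part linear_s_part)
  \<comment> \<open>Differences are written as sums with factors or summands -1, so that the closure
    rules apply syntactically.\<close>
  have "is_quadratic (\<lambda>y. (x_part y \<bullet> (Q\<^sub>0 *v x_part y) + 2 * (q\<^sub>0 \<bullet> x_part y))
     + (u $ 1 * ((norm (x_part y - 0))\<^sup>2 + (- 1)) + u $ 2 * ((norm (A *v x_part y - a))\<^sup>2 + (- 1))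
        + u $ 3 * (norm (B *v x_part y + s_part y - b))\<^sup>2)
     + (- 1) * (v \<bullet> s_part y))"
    by (intro is_quadratic_add is_quadratic_cmult is_quadratic_const is_quadratic_inner
        is_quadratic_linear inner x A B linear_x_part linear_mult_x_part linear_s_part)
  then show ?thesis
    by (simp add: lagrangian_def[abs_def] f0_bar_def f1_bar_def f2_bar_def f3_bar_def)
qed

section \<open>Homogenisation and copositivity of Shor matrices\<close>

lemma sum_UNIV_option:
  fixes g :: "'m::finite option \<Rightarrow> 'a::comm_monoid_add"
  shows "(\<Sum>i\<in>UNIV. g i) = g None + (\<Sum>j\<in>UNIV. g (Some j))"
  by (simp add: UNIV_option_conv sum.reindex)

text \<open>This is the homogenisation of \<open>quadratic_fun H d \<gamma>\<close>: with t the
  leading entry, it equals t^2 q(y/t) when t is nonzero and the pure quadratic form when t =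
  0.\<close>

lemma inner_shor_block:
  fixes w :: "real^('m::finite option)"
  defines "y \<equiv> (\<chi> j. w $ Some j)"
  shows "w \<bullet> (shor_block H d \<gamma> *v w) =
    y \<bullet> (H *v y) - 2 * w $ None * (d \<bullet> y) + \<gamma> * (w $ None)\<^sup>2"
proof -
  have "(shor_block H d \<gamma> *v w) $ None = \<gamma> * w $ None - d \<bullet> y"
    by (simp add: matrix_vector_mult_def sum_UNIV_option shor_block_def inner_vec_def y_def
        sum_negf)
  moreover have "(shor_block H d \<gamma> *v w) $ Some i = (H *v y) $ i - d $ i * w $ None" for i
    by (simp add: matrix_vector_mult_def sum_UNIV_option shor_block_def y_def)
  ultimately have "w \<bullet> (shor_block H d \<gamma> *v w) =
      w $ None * (\<gamma> * w $ None - d \<bullet> y) + (\<Sum>i\<in>UNIV. y $ i * ((H *v y) $ i - d $ i * w $ None))"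
    by (simp add: inner_vec_def[of w] sum_UNIV_option y_def)
  also have "(\<Sum>i\<in>UNIV. y $ i * ((H *v y) $ i - d $ i * w $ None)) =
      y \<bullet> (H *v y) - w $ None * (d \<bullet> y)"
    by (simp add: inner_vec_def right_diff_distrib sum_subtractf sum_distrib_left mult_ac)
  finally show ?thesis by (simp add: power2_eq_square algebra_simps)
qed

text \<open>A negative leading coefficient would dominate the other terms for large k. This handles
  the points at infinity in the copositivity criterion.\<close>

lemma leading_coeff_nonneg:
  fixes h c g :: real
  assumes "\<And>k. 0 < k \<Longrightarrow> 0 \<le> k\<^sup>2 * h - k * c + g"
  shows "0 \<le> h"
proof (rule ccontr)
  assume "\<not> 0 \<le> h"
  then have h: "h < 0" by simp
  \<comment> \<open>Chosen so that k h = h - (|c| + |g|). Since k is at least 1, the polynomial at k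
    is then at most k h, which is negative.\<close>
  define k where "k = (\<bar>c\<bar> + \<bar>g\<bar>) / (- h) + 1"
  have k: "k \<ge> 1" using h by (simp add: k_def divide_nonneg_neg)
  have "k * h = h - (\<bar>c\<bar> + \<bar>g\<bar>)" using h by (simp add: k_def field_simps)
  then have "k\<^sup>2 * h = k * h - k * \<bar>c\<bar> - k * \<bar>g\<bar>"
    by (metis mult.assoc power2_eq_square right_diff_distrib diff_diff_add distrib_left)
  moreover have "k * \<bar>g\<bar> \<ge> \<bar>g\<bar>" using k mult_right_mono[of 1 k "\<bar>g\<bar>"] by simp
  moreover have "- (k * c) \<le> k * \<bar>c\<bar>"
    using k mult_left_mono[of "-c" "\<bar>c\<bar>" k] by simp
  moreover have "k * h < 0" using k h by (simp add: mult_pos_neg)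
  ultimately show False using assms[of k] k by linarith
qed

text \<open>A vector of \<open>Upsilon\<close> is a pair (t, y) with t and the slack part of y
  nonnegative. For t > 0 the form is t^2 (q(y/t) - \<mu>), and division by t preserves the sign of
  the slack part. For t = 0 it is the quadratic part of q, nonnegative because q is bounded below on
  the ray through y. Conversely, t = 1 recovers q(y) - \<mu>.\<close>

lemma copositive_shor_iff:
  fixes q :: "real^('p::finite + 'n::finite) \<Rightarrow> real"
  assumes "is_quadratic q"
  shows "copositive_on Upsilon (shor_matrix q - \<mu> *\<^sub>R J0) \<longleftrightarrow> (\<forall>y. 0 \<le> s_part y \<longrightarrow> \<mu> \<le> q y)"
proof -
  obtain H d \<gamma> where H: "symmetric_matrix H" and q: "q = quadratic_fun H d \<gamma>"
    using assms by (auto simp: is_quadratic_def)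
  \<comment> \<open>Subtracting \<open>\<mu> *\<^sub>R J0\<close> changes only the constant term, so
    this is the Shor matrix of q - \<mu>.\<close>
  define S where "S = shor_block H d (\<gamma> - \<mu>)"
  have S: "shor_matrix q - \<mu> *\<^sub>R J0 = S"
    unfolding q shor_matrix_eq[OF H] S_def
    by (auto simp: shor_block_def J0_def vec_eq_iff split: option.splits)
  have "symmetric_matrix S"
    using H by (auto simp: symmetric_matrix_def S_def shor_block_def transpose_def vec_eq_iff
        split: option.splits)
  then have cop: "copositive_on Upsilon (shor_matrix q - \<mu> *\<^sub>R J0) \<longleftrightarrow>
      (\<forall>w\<in>Upsilon. 0 \<le> w \<bullet> (S *v w))"
    by (simp add: S copositive_on_def)
  show ?thesis unfolding cop
  proof safe
    fix y :: "real^('p + 'n)"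
    assume nonneg: "\<forall>w\<in>Upsilon. 0 \<le> w \<bullet> (S *v w)" and y: "0 \<le> s_part y"
    define w where "w = (\<chi> i. case i of None \<Rightarrow> 1 | Some j \<Rightarrow> y $ j)"
    have "w \<in> Upsilon"
      using y by (simp add: w_def Upsilon_def s_part_def less_eq_vec_def)
    then have "0 \<le> w \<bullet> (S *v w)" using nonneg by blast
    then show "\<mu> \<le> q y"
      by (simp add: S_def inner_shor_block w_def q quadratic_fun_def)
  next
    fix w :: "real^(('p + 'n) option)"
    assume ge: "\<forall>y. 0 \<le> s_part y \<longrightarrow> \<mu> \<le> q y" and w: "w \<in> Upsilon"
    define y where "y = (\<chi> j. w $ Some j)"
    define t where "t = w $ None"
    have t: "t \<ge> 0" using w by (simp add: Upsilon_def t_def)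
    have scaled: "0 \<le> k\<^sup>2 * (y \<bullet> (H *v y)) - k * (2 * (d \<bullet> y)) + (\<gamma> - \<mu>)" if "0 < k" for k
    proof -
      have "0 \<le> s_part (k *\<^sub>R y)"
        using w that by (simp add: y_def Upsilon_def s_part_def less_eq_vec_def)
      then have "\<mu> \<le> q (k *\<^sub>R y)" using ge by blast
      then show ?thesis
        by (simp add: q quadratic_fun_def matrix_vector_mult_scaleR power2_eq_square mult.assoc
            mult.left_commute)
    qed
    have "0 \<le> y \<bullet> (H *v y) - 2 * t * (d \<bullet> y) + (\<gamma> - \<mu>) * t\<^sup>2"
    proof (cases "t = 0")
      case True
      then show ?thesis using leading_coeff_nonneg[OF scaled] by simp
    next
      case False
      then have "0 \<le> t\<^sup>2 * ((1/t)\<^sup>2 * (y \<bullet> (H *v y)) - (1/t) * (2 * (d \<bullet> y)) + (\<gamma> - \<mu>))"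
        using t scaled[of "1/t"] by simp
      also have "\<dots> = y \<bullet> (H *v y) - 2 * t * (d \<bullet> y) + (\<gamma> - \<mu>) * t\<^sup>2"
        using False by (simp add: field_simps power2_eq_square)
      finally show ?thesis .
    qed
    then show "0 \<le> w \<bullet> (S *v w)"
      by (simp add: S_def inner_shor_block y_def t_def)
  qed
qed

section \<open>Weak inequalities between the relaxations\<close>

text \<open>On nonnegative slacks, dropping the term with v can only increase the Lagrangian. Hence
  a finite dual value at (u, v) is an admissible \<mu> for the copositive problem with the same
  u.\<close>

lemma lagrangian_value_le_copositive_value:
  fixes B :: "real^'n^'p"
  shows "lagrangian_value Q\<^sub>0 q\<^sub>0 A a B b \<le> copositive_value Q\<^sub>0 q\<^sub>0 A a B b"
  unfolding lagrangian_value_def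
proof (rule Sup_least, safe)
  fix u :: "real^3" and v :: "real^'p"
  assume u: "0 \<le> u" and v: "0 \<le> v"
  let ?L = "lagrangian Q\<^sub>0 q\<^sub>0 A a B b"
  have le: "dual_fun Q\<^sub>0 q\<^sub>0 A a B b u v \<le> ereal (?L u v y)" for y
    unfolding dual_fun_def by (rule INF_lower) simp
  show "dual_fun Q\<^sub>0 q\<^sub>0 A a B b u v \<le> copositive_value Q\<^sub>0 q\<^sub>0 A a B b"
  proof (cases "dual_fun Q\<^sub>0 q\<^sub>0 A a B b u v")
    case (real \<mu>)
    have "\<mu> \<le> ?L u 0 y" if "0 \<le> s_part y" for y
    proof -
      have "0 \<le> v \<bullet> s_part y"
        using v that by (simp add: inner_vec_def less_eq_vec_def sum_nonneg)
      then show ?thesis using le[of y] real by (simp add: lagrangian_def)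
    qed
    then have "copositive_on Upsilon (shor_matrix (?L u 0) - \<mu> *\<^sub>R J0)"
      by (simp add: copositive_shor_iff is_quadratic_lagrangian)
    then show ?thesis
      unfolding real copositive_value_def using u by (intro Sup_upper) blast
  next
    \<comment> \<open>An infimum of real values over a nonempty set cannot be infinite from above;
      the value -\<infinity> is trivial.\<close>
    case PInf
    then show ?thesis using le[of 0] by simp
  qed simp
qed

definition join_parts :: "real^'p \<Rightarrow> real^'n \<Rightarrow> real^('p::finite + 'n::finite)" where
  "join_parts s x = (\<chi> i. case i of Inl j \<Rightarrow> s $ j | Inr j \<Rightarrow> x $ j)"

lemma s_part_join [simp]: "s_part (join_parts s x) = s"
  by (simp add: s_part_def join_parts_def vec_eq_iff)

lemma x_part_join [simp]: "x_part (join_parts s x) = x"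
  by (simp add: x_part_def join_parts_def vec_eq_iff)

lemma copositive_value_le_cdt_value:
  "copositive_value Q\<^sub>0 q\<^sub>0 A a B b \<le> cdt_value Q\<^sub>0 q\<^sub>0 A a B b"
  unfolding copositive_value_def cdt_value_def
proof (intro Sup_least INF_greatest, safe)
  fix x \<mu> and u :: "real^3"
  assume x: "x \<in> cdt_feasible A a B b" and u: "0 \<le> u"
    and cop: "copositive_on Upsilon (shor_matrix (lagrangian Q\<^sub>0 q\<^sub>0 A a B b u 0) - \<mu> *\<^sub>R J0)"
  \<comment> \<open>The exact slack of x is nonnegative and makes \<open>f3_bar\<close> vanish, so
    its multiplier has no effect.\<close>
  let ?y = "join_parts (b - B *v x) x"
  have "0 \<le> s_part ?y"
    using x by (simp add: cdt_feasible_def)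
  then have "\<mu> \<le> lagrangian Q\<^sub>0 q\<^sub>0 A a B b u 0 ?y"
    using cop by (simp add: copositive_shor_iff is_quadratic_lagrangian)
  also have "\<dots> = cdt_objective Q\<^sub>0 q\<^sub>0 x
      + u $ 1 * ((norm x)\<^sup>2 - 1) + u $ 2 * ((norm (A *v x - a))\<^sup>2 - 1)"
    by (simp add: lagrangian_def f0_bar_def f1_bar_def f2_bar_def f3_bar_def cdt_objective_def)
  also have "\<dots> \<le> cdt_objective Q\<^sub>0 q\<^sub>0 x"
  proof -
    have "0 \<le> u $ 1" "0 \<le> u $ 2" using u by (simp_all add: less_eq_vec_def)
    then have "u $ 1 * ((norm x)\<^sup>2 - 1) \<le> 0" "u $ 2 * ((norm (A *v x - a))\<^sup>2 - 1) \<le> 0"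
      using x by (simp_all add: cdt_feasible_def mult_nonneg_nonpos)
    then show ?thesis by simp
  qed
  finally show "ereal \<mu> \<le> ereal (cdt_objective Q\<^sub>0 q\<^sub>0 x)" by simp
qed

section \<open>A convex theorem of the alternative\<close>

text \<open>The set of all vectors dominating some value of F is convex. Bounded sublevel sets keep
  0 out of its closure, so 0 can be strictly separated from it; as the set is closed under adding
  nonnegative vectors, the separating functional is nonnegative on them.\<close>

lemma convex_alternative:
  fixes F :: "'a::euclidean_space \<Rightarrow> 'b::ordered_euclidean_space"
  assumes convex: "\<And>x y t. 0 \<le> t \<Longrightarrow> t \<le> 1 \<Longrightarrow>
      F ((1 - t) *\<^sub>R x + t *\<^sub>R y) \<le> (1 - t) *\<^sub>R F x + t *\<^sub>R F y"
    and cont: "continuous_on UNIV F"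
    and bounded: "bounded {y. F y \<le> One}"
    and infeasible: "\<And>y. \<not> F y \<le> 0"
  obtains w where "\<And>r. 0 \<le> r \<Longrightarrow> 0 \<le> w \<bullet> r" and "\<And>y. 0 < w \<bullet> F y"
proof -
  define C where "C = {z. \<exists>y. F y \<le> z}"
  have "convex C"
  proof (rule convexI)
    fix z z' and s t :: real
    assume "z \<in> C" "z' \<in> C" and st: "0 \<le> s" "0 \<le> t" "s + t = 1"
    then obtain y y' where y: "F y \<le> z" "F y' \<le> z'" by (auto simp: C_def)
    have "F (s *\<^sub>R y + t *\<^sub>R y') \<le> s *\<^sub>R F y + t *\<^sub>R F y'"
    proof -
      have "s = 1 - t" using st(3) by simp
      then show ?thesis using convex[of t y y'] \<open>0 \<le> t\<close> \<open>0 \<le> s\<close> by simp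
    qed
    also have "\<dots> \<le> s *\<^sub>R z + t *\<^sub>R z'"
      using y st by (intro add_mono scaleR_left_mono)
    finally show "s *\<^sub>R z + t *\<^sub>R z' \<in> C" by (auto simp: C_def)
  qed
  \<comment> \<open>If z n tends to 0 with F (y n) below z n, then eventually F (y n) lies below
    \<open>One\<close>. By compactness a subsequence of y n converges, and continuity gives a limit
    l with F l \<le> 0.\<close>
  have "0 \<notin> closure C"
  proof
    assume "0 \<in> closure C"
    then obtain z where z: "\<And>n. z n \<in> C" "z \<longlonglongrightarrow> 0"
      by (auto simp: closure_sequential)
    have "\<forall>n. \<exists>y. F y \<le> z n" using z(1) by (simp add: C_def)
    then obtain y where y: "\<And>n. F (y n) \<le> z n" by metis
    have "eventually (\<lambda>n. norm (z n) < 1) sequentially"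
      using z(2) by (metis norm_zero order_tendstoD(2) tendsto_norm zero_less_one)
    then obtain N where N: "\<And>n. n \<ge> N \<Longrightarrow> norm (z n) < 1"
      by (auto simp: eventually_sequentially)
    have inS: "y (n + N) \<in> closure {y. F y \<le> One}" for n
    proof -
      have "z (n + N) \<le> One"
        unfolding eucl_le[where 'a='b]
      proof
        fix i :: 'b assume i: "i \<in> Basis"
        show "z (n + N) \<bullet> i \<le> One \<bullet> i"
          using i N[of "n + N"] Basis_le_norm[OF i, of "z (n + N)"] by simp
      qed
      then have "y (n + N) \<in> {y. F y \<le> One}" using order_trans[OF y] by simp
      then show ?thesis using closure_subset by (rule subsetD[rotated])
    qed
    have "compact (closure {y. F y \<le> One})" using bounded by simp
    then obtain l r where r: "strict_mono (r :: nat \<Rightarrow> nat)"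
      and lim: "((\<lambda>n. y (n + N)) \<circ> r) \<longlonglongrightarrow> l"
      using inS compact_imp_seq_compact seq_compactE by metis
    have "(\<lambda>n. F (((\<lambda>n. y (n + N)) \<circ> r) n)) \<longlonglongrightarrow> F l"
      using continuous_on_tendsto_compose[OF cont lim] by simp
    moreover have "(\<lambda>n. ((\<lambda>n. z (n + N)) \<circ> r) n) \<longlonglongrightarrow> 0"
      using LIMSEQ_subseq_LIMSEQ[OF LIMSEQ_ignore_initial_segment[OF z(2)] r] by (simp add: o_def)
    ultimately have "(\<lambda>n. ((\<lambda>n. z (n + N)) \<circ> r) n - F (((\<lambda>n. y (n + N)) \<circ> r) n)) \<longlonglongrightarrow> 0 - F l"
      by (rule tendsto_diff[rotated])
    moreover have "closed {0::'b..}" by (rule closed_eucl_atLeast)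
    ultimately have "0 - F l \<in> {0..}"
      by (rule closed_sequentially[rotated, rotated]) (simp add: y)
    then show False using infeasible[of l] by simp
  qed
  then obtain w c where c: "w \<bullet> 0 < c" and sep: "\<And>z. z \<in> closure C \<Longrightarrow> c < w \<bullet> z"
    using separating_hyperplane_closed_point[of "closure C" 0] \<open>convex C\<close> convex_closure by blast
  have sepF: "c < w \<bullet> F y + w \<bullet> r" if "0 \<le> r" for y r
  proof -
    have "F y \<le> F y + r" using that by simp
    then have "F y + r \<in> C" unfolding C_def by blast
    then have "F y + r \<in> closure C" by (rule subsetD[OF closure_subset])
    then show ?thesis using sep by (metis inner_add_right)
  qed
  have "0 \<le> w \<bullet> r" if r: "0 \<le> r" for r
  proof (rule ccontr)
    assume "\<not> 0 \<le> w \<bullet> r"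
    then have neg: "w \<bullet> r < 0" by simp
    \<comment> \<open>Moving k steps along r lowers the functional by |w \<bullet> F 0|, making it
      nonpositive although it must exceed c > 0.\<close>
    define k where "k = \<bar>w \<bullet> F 0\<bar> / - (w \<bullet> r)"
    have "0 \<le> k" using neg by (simp add: k_def divide_nonneg_neg)
    then have "c < w \<bullet> F 0 + w \<bullet> (k *\<^sub>R r)" using r by (intro sepF) (simp add: scaleR_nonneg_nonneg)
    also have "\<dots> = w \<bullet> F 0 - \<bar>w \<bullet> F 0\<bar>" using neg by (simp add: k_def)
    finally show False using c by simp
  qed
  moreover have "0 < w \<bullet> F y" for y using sepF[of 0 y] c by simp
  ultimately show ?thesis using that by blast
qed

section \<open>Convexity inequalities\<close>

text \<open>The difference of the two sides is exactly t (1 - t) times the form at x - y.\<close>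

lemma convex_quadratic_form:
  fixes P :: "real^'n^'n" and x y :: "real^'n"
  assumes sym: "symmetric_matrix P" and psd: "\<And>z. 0 \<le> z \<bullet> (P *v z)" and t: "0 \<le> t" "t \<le> 1"
  defines "z \<equiv> (1 - t) *\<^sub>R x + t *\<^sub>R y"
  shows "z \<bullet> (P *v z) \<le> (1 - t) * (x \<bullet> (P *v x)) + t * (y \<bullet> (P *v y))"
proof -
  have "(1 - t) * (x \<bullet> (P *v x)) + t * (y \<bullet> (P *v y)) - z \<bullet> (P *v z) =
      t * (1 - t) * ((x - y) \<bullet> (P *v (x - y)))"
    unfolding z_def
    by (simp add: matrix_vector_mult_scaleR matrix_vector_mult_diff_distrib matrix_vector_right_distrib
        inner_add_left inner_add_right inner_diff_left inner_diff_right
        symmetric_inner[OF sym, of y x]) (simp add: algebra_simps power2_eq_square)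
  moreover have "\<dots> \<ge> 0" using t psd by simp
  ultimately show ?thesis by linarith
qed

lemma convex_norm_affine:
  fixes f :: "'a::real_vector \<Rightarrow> 'b::real_inner"
  assumes lin: "linear f" and t: "0 \<le> t" "t \<le> 1"
  shows "(norm (f ((1 - t) *\<^sub>R x + t *\<^sub>R y) - c))\<^sup>2 \<le>
    (1 - t) * (norm (f x - c))\<^sup>2 + t * (norm (f y - c))\<^sup>2"
proof -
  define p q where "p = f x - c" and "q = f y - c"
  have "f ((1 - t) *\<^sub>R x + t *\<^sub>R y) - c = (1 - t) *\<^sub>R p + t *\<^sub>R q"
    unfolding p_def q_def linear_add[OF lin] linear_scale[OF lin] by (simp add: algebra_simps)
  moreover have "(1 - t) * (norm p)\<^sup>2 + t * (norm q)\<^sup>2 - (norm ((1 - t) *\<^sub>R p + t *\<^sub>R q))\<^sup>2 =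
      t * (1 - t) * (norm (p - q))\<^sup>2"
    unfolding power2_norm_eq_inner
    by (simp add: inner_add_left inner_add_right inner_diff_left inner_diff_right
        inner_commute[of q p]) (simp add: algebra_simps power2_eq_square)
  moreover have "t * (1 - t) * (norm (p - q))\<^sup>2 \<ge> 0" using t by simp
  ultimately show ?thesis by (simp add: p_def q_def)
qed

section \<open>Moving along kernel directions\<close>

lemma ker_stack_rows: "ker (stack_rows P A) = {v. P *v v = 0 \<and> A *v v = 0}"
proof -
  have "stack_rows P A *v v = 0 \<longleftrightarrow> P *v v = 0 \<and> A *v v = 0" for v
  proof -
    have "(stack_rows P A *v v) $ Inl i = (P *v v) $ i" for i
      by (simp add: stack_rows_def matrix_vector_mult_def)
    moreover have "(stack_rows P A *v v) $ Inr i = (A *v v) $ i" for i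
      by (simp add: stack_rows_def matrix_vector_mult_def)
    ultimately show ?thesis
      by (auto simp: vec_eq_iff split_sum_all)
  qed
  then show ?thesis by (simp add: ker_def)
qed

text \<open>Along v the value of A x is constant and B x does not increase, so only the norm
  constraint can fail. The norm starts at most 1 and later reaches at least 1, so it equals 1 in
  between.\<close>

lemma feasible_slide_to_sphere:
  assumes x: "x \<in> cdt_feasible A a B b" and v: "v \<noteq> 0"
    and Av: "A *v v = 0" and Bv: "B *v v \<le> 0"
  obtains t where "0 \<le> t" "x + t *\<^sub>R v \<in> cdt_feasible A a B b" "norm (x + t *\<^sub>R v) = 1"
proof -
  have nx: "norm x \<le> 1" using x by (simp add: cdt_feasible_def power_le_one_iff)
  \<comment> \<open>A displacement of length 2 from a point of the unit ball ends at norm at least 2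
    - 1.\<close>
  have "1 \<le> norm (x + (2 / norm v) *\<^sub>R v)"
    using norm_diff_ineq[of "(2 / norm v) *\<^sub>R v" x] nx v by (simp add: add.commute)
  moreover have "continuous_on {0..2 / norm v} (\<lambda>t. norm (x + t *\<^sub>R v))"
    by (intro continuous_intros)
  ultimately obtain t where t: "0 \<le> t" "norm (x + t *\<^sub>R v) = 1"
    using IVT'[of "\<lambda>t. norm (x + t *\<^sub>R v)" 0 1 "2 / norm v"] nx by auto
  have "B *v (x + t *\<^sub>R v) = B *v x + t *\<^sub>R (B *v v)"
    by (simp add: matrix_vector_right_distrib matrix_vector_mult_scaleR)
  also have "\<dots> \<le> b + 0"
    using x t(1) Bv by (intro add_mono) (auto simp: cdt_feasible_def less_eq_vec_def mult_nonneg_nonpos)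
  finally have "x + t *\<^sub>R v \<in> cdt_feasible A a B b"
    using x t Av by (simp add: cdt_feasible_def matrix_vector_right_distrib matrix_vector_mult_scaleR)
  then show ?thesis using that t by blast
qed

section \<open>Duality for the convexified problem\<close>

lemma axis_nonneg: "0 \<le> c \<Longrightarrow> 0 \<le> (axis i c :: real^'n)"
  by (simp add: less_eq_vec_def axis_def)

text \<open>No Slater condition is needed because the constraint \<open>norm x \<le> 1\<close> makes the
  sublevel sets of the perturbed problems compact. A separating functional with vanishing weight
  on the objective would be nonpositive at a feasible point, so feasibility alone excludes it.\<close>
lemma convex_strong_duality:
  fixes Q\<^sub>0 :: "real^'n^'n" and A :: "real^'n^'l" and B :: "real^'n^'p"
  assumes sym: "symmetric_matrix Q\<^sub>0" and psd: "\<And>z. 0 \<le> z \<bullet> (Q\<^sub>0 *v z) + \<sigma> * (z \<bullet> z)"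
    and \<sigma>: "0 \<le> \<sigma>" and feas: "cdt_feasible A a B b \<noteq> {}"
    and bound: "\<And>x. x \<in> cdt_feasible A a B b \<Longrightarrow> m \<le> cdt_objective Q\<^sub>0 q\<^sub>0 x + \<sigma> * ((norm x)\<^sup>2 - 1)"
  shows "ereal m \<le> lagrangian_value Q\<^sub>0 q\<^sub>0 A a B b"
proof (rule ereal_le_epsilon2)
  fix e :: real
  assume e: "0 < e"
  define P where "P = Q\<^sub>0 + \<sigma> *\<^sub>R mat 1"
  have symP: "symmetric_matrix P"
    using sym by (auto simp: P_def intro!: symmetric_matrix_add symmetric_matrix_scaleR)
       (simp add: symmetric_matrix_def)
  have formP: "z \<bullet> (P *v z) = z \<bullet> (Q\<^sub>0 *v z) + \<sigma> * (z \<bullet> z)" for z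
    by (simp add: P_def matrix_vector_mult_add_rdistrib scaleR_matrix_vector_assoc[symmetric] inner_add_right)
  \<comment> \<open>The shifted objective minus m - e. It is at least e on the feasible set, so the
    system below has no solution; e is removed at the end by letting it tend to 0.\<close>
  define h where "h x = x \<bullet> (P *v x) + 2 * (q\<^sub>0 \<bullet> x) - \<sigma> - m + e" for x
  have h: "h x = cdt_objective Q\<^sub>0 q\<^sub>0 x + \<sigma> * ((norm x)\<^sup>2 - 1) - m + e" for x
    by (simp add: h_def formP cdt_objective_def power2_norm_eq_inner algebra_simps)
  define f :: "real^('p + 'n) \<Rightarrow> real^3"
    where "f y = vector [f1_bar y, f2_bar A a y, f3_bar B b y]" for y
  have fs: "f y $ 1 = f1_bar y" "f y $ 2 = f2_bar A a y" "f y $ 3 = f3_bar B b y" for y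
    by (simp_all add: f_def)
  \<comment> \<open>The system F y \<le> 0 encodes feasibility together with h \<le> 0: the last
    block says s \<ge> 0, and \<open>f3_bar\<close>, being a square, is nonpositive only if B x + s
    = b.\<close>
  define F where "F y = (h (x_part y), f y, - s_part y)" for y :: "real^('p + 'n)"
  have lin: "linear (\<lambda>y. B *v x_part y + s_part y)"
    by (intro linear_compose_add linear_mult_x_part linear_s_part)
  have cont: "continuous_on UNIV F"
  proof -
    have s: "continuous_on UNIV s_part" and x: "continuous_on UNIV x_part"
      by (simp_all add: linear_continuous_on linear_conv_bounded_linear[symmetric]
          linear_s_part linear_x_part)
    have M: "continuous_on UNIV (\<lambda>y. M *v x_part y)" for M :: "real^'n^'k"
      by (simp add: linear_continuous_on linear_conv_bounded_linear[symmetric] linear_mult_x_part)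
    have "continuous_on UNIV (\<lambda>y. f y $ i)" for i
      using exhaust_3[of i]
      by (elim disjE) (simp_all only: fs f1_bar_def f2_bar_def f3_bar_def,
          (intro continuous_intros s x M)+)
    then have "continuous_on UNIV f"
      using continuous_on_vec_lambda[of UNIV "\<lambda>i y. f y $ i"] by simp
    then show ?thesis
      unfolding F_def h_def by (intro continuous_intros s x M)
  qed
  have convex: "F ((1 - t) *\<^sub>R y + t *\<^sub>R z) \<le> (1 - t) *\<^sub>R F y + t *\<^sub>R F z"
    if t: "0 \<le> t" "t \<le> 1" for y z t
  proof -
    let ?w = "(1 - t) *\<^sub>R y + t *\<^sub>R z"
    have xw: "x_part ?w = (1 - t) *\<^sub>R x_part y + t *\<^sub>R x_part z"
      and sw: "s_part ?w = (1 - t) *\<^sub>R s_part y + t *\<^sub>R s_part z"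
      by (simp_all add: linear_x_part linear_s_part linear_add linear_scale)
    have "h (x_part ?w) \<le> (1 - t) * h (x_part y) + t * h (x_part z)"
      using convex_quadratic_form[OF symP _ t, of "x_part y" "x_part z"] psd
      by (simp add: formP[symmetric] h_def xw inner_add_right) (simp add: algebra_simps)
    moreover have "f ?w \<le> (1 - t) *\<^sub>R f y + t *\<^sub>R f z"
      using convex_norm_affine[OF linear_x_part t, of y z 0]
        convex_norm_affine[OF linear_mult_x_part t, of A y z a]
        convex_norm_affine[OF lin t, of y z b]
      by (simp add: less_eq_vec_def forall_3 fs f1_bar_def f2_bar_def f3_bar_def)
        (simp add: algebra_simps)
    ultimately show ?thesis
      by (simp add: F_def less_eq_prod_def sw)
  qed
  \<comment> \<open>The component \<open>f1_bar\<close> bounds x and \<open>f3_bar\<close> bounds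
    the residual B x + s - b; together they bound s.\<close>
  have "bounded {y. F y \<le> One}"
  proof (rule boundedI)
    fix y assume "y \<in> {y. F y \<le> One}"
    then have le: "F y \<bullet> i \<le> 1" if "i \<in> Basis" for i
      using that by (auto simp: eucl_le[where 'a = "real \<times> (real^3) \<times> (real^'p)"])
    have f: "f y $ k \<le> 1" for k
      using le[of "(0, axis k 1, 0)"] by (simp add: F_def Basis_prod_def inner_axis axis_in_Basis_iff)
    have "(norm (x_part y))\<^sup>2 \<le> 2\<^sup>2" using f[of 1] by (simp add: fs f1_bar_def)
    then have x: "norm (x_part y) \<le> 2" by (rule power2_le_imp_le) simp
    have "(norm (B *v x_part y + s_part y - b))\<^sup>2 \<le> 1\<^sup>2" using f[of 3] by (simp add: fs f3_bar_def)
    then have r: "norm (B *v x_part y + s_part y - b) \<le> 1" by (rule power2_le_imp_le) simp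
    have "norm (B *v x_part y) \<le> onorm ((*v) B) * norm (x_part y)"
      by (rule onorm) simp
    also have "\<dots> \<le> onorm ((*v) B) * 2"
      using x by (intro mult_left_mono onorm_pos_le) simp_all
    finally have Bx: "norm (B *v x_part y) \<le> onorm ((*v) B) * 2" .
    have "norm (s_part y) \<le> norm (B *v x_part y + s_part y - b) + norm b + norm (B *v x_part y)"
      using norm_triangle_ineq4[of "B *v x_part y + s_part y - b + b" "B *v x_part y"]
        norm_triangle_ineq[of "B *v x_part y + s_part y - b" b] by simp
    then have s: "norm (s_part y) \<le> 1 + norm b + onorm ((*v) B) * 2" using r Bx by linarith
    have "(norm y)\<^sup>2 = (norm (s_part y))\<^sup>2 + (norm (x_part y))\<^sup>2"
      by (simp add: power2_norm_eq_inner inner_vec_def s_part_def x_part_def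
          UNIV_Plus_UNIV[symmetric] sum.Plus del: UNIV_Plus_UNIV)
    also have "\<dots> \<le> (norm (s_part y) + norm (x_part y))\<^sup>2"
      by (simp add: power2_sum)
    finally have "norm y \<le> norm (s_part y) + norm (x_part y)"
      by (rule power2_le_imp_le) simp
    then show "norm y \<le> 1 + norm b + onorm ((*v) B) * 2 + 2" using s x by linarith
  qed
  moreover have "\<not> F y \<le> 0" for y
  proof
    assume "F y \<le> 0"
    then have hy: "h (x_part y) \<le> 0" and fy: "f y \<le> 0" and s: "0 \<le> s_part y"
      by (simp_all add: F_def less_eq_prod_def)
    have "norm (B *v x_part y + s_part y - b) = 0"
      using fy by (simp add: less_eq_vec_def forall_3 fs f3_bar_def)
    then have "B *v x_part y = b - s_part y" by (simp add: algebra_simps)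
    then have "x_part y \<in> cdt_feasible A a B b"
      using fy s by (simp add: cdt_feasible_def less_eq_vec_def forall_3 fs f1_bar_def f2_bar_def)
    then show False using bound[of "x_part y"] hy e by (simp add: h)
  qed
  ultimately obtain w where w: "\<And>r. 0 \<le> r \<Longrightarrow> 0 \<le> w \<bullet> r" and pos: "\<And>y. 0 < w \<bullet> F y"
    using convex_alternative[of F] convex cont by blast
  obtain \<alpha> u v where wdef: "w = (\<alpha>, u, v)" by (cases w)
  have \<alpha>0: "0 \<le> \<alpha>" using w[of "(1, 0, 0)"] by (simp add: wdef less_eq_prod_def)
  have u: "0 \<le> u $ i" for i
    using w[of "(0, axis i 1, 0)"]
    by (simp add: wdef less_eq_prod_def inner_axis axis_nonneg)
  have v: "0 \<le> v $ i" for i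
    using w[of "(0, 0, axis i 1)"]
    by (simp add: wdef less_eq_prod_def inner_axis axis_nonneg)
  have posF: "0 < \<alpha> * h (x_part y) + u \<bullet> f y - v \<bullet> s_part y" for y
    using pos[of y] by (simp add: wdef F_def)
  have "\<alpha> \<noteq> 0"
  proof
    assume "\<alpha> = 0"
    obtain x where x: "x \<in> cdt_feasible A a B b" using feas by blast
    let ?y = "join_parts (b - B *v x) x"
    have "f ?y $ i \<le> 0" for i
      using x exhaust_3[of i] by (auto simp: fs f1_bar_def f2_bar_def f3_bar_def cdt_feasible_def)
    then have "u \<bullet> f ?y \<le> 0"
      unfolding inner_vec_def by (intro sum_nonpos) (simp add: mult_nonneg_nonpos u)
    moreover have "0 \<le> v \<bullet> s_part ?y"
      unfolding inner_vec_def using x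
      by (intro sum_nonneg) (simp add: v cdt_feasible_def less_eq_vec_def)
    ultimately show False using posF[of ?y] \<open>\<alpha> = 0\<close> by simp
  qed
  with \<alpha>0 have \<alpha>: "0 < \<alpha>" by simp
  \<comment> \<open>Dividing by \<alpha> gives the objective weight 1. The shift in h is \<sigma>
    times \<open>f1_bar\<close>, hence the extra \<sigma> in the first coordinate.\<close>
  define u' where "u' = (1 / \<alpha>) *\<^sub>R u + \<sigma> *\<^sub>R axis 1 1"
  define v' where "v' = (1 / \<alpha>) *\<^sub>R v"
  have "m - e \<le> lagrangian Q\<^sub>0 q\<^sub>0 A a B b u' v' y" for y
  proof -
    have "0 < (\<alpha> * h (x_part y) + u \<bullet> f y - v \<bullet> s_part y) / \<alpha>" using posF \<alpha> by simp
    also have "\<dots> = h (x_part y) + ((1 / \<alpha>) *\<^sub>R u) \<bullet> f y - v' \<bullet> s_part y"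
      using \<alpha> by (simp add: v'_def field_simps)
    also have "\<dots> = lagrangian Q\<^sub>0 q\<^sub>0 A a B b u' v' y - m + e"
      by (simp add: lagrangian_def u'_def h f0_bar_def cdt_objective_def inner_vec_def sum_3 fs
          axis_def f1_bar_def diff_divide_distrib algebra_simps)
    finally show ?thesis by simp
  qed
  then have "ereal (m - e) \<le> dual_fun Q\<^sub>0 q\<^sub>0 A a B b u' v'"
    unfolding dual_fun_def by (intro INF_greatest) simp
  also have "\<dots> \<le> lagrangian_value Q\<^sub>0 q\<^sub>0 A a B b"
  proof -
    have "0 \<le> u'" "0 \<le> v'"
      using u v \<alpha> \<sigma> by (auto simp: u'_def v'_def less_eq_vec_def axis_def)
    then show ?thesis unfolding lagrangian_value_def by (intro Sup_upper) blast
  qed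
  finally have "ereal (m - e) + ereal e \<le> lagrangian_value Q\<^sub>0 q\<^sub>0 A a B b + ereal e"
    by (rule add_right_mono)
  then show "ereal m \<le> lagrangian_value Q\<^sub>0 q\<^sub>0 A a B b + ereal e" by simp
qed

section \<open>Closing the chain of inequalities\<close>

theorem theorem5p1:
  fixes Q\<^sub>0 :: "real^'n^'n" and q\<^sub>0 :: "real^'n"
    and A :: "real^'n^'l" and a :: "real^'l"
    and B :: "real^'n^'p" and b :: "real^'p"
  assumes "symmetric_matrix Q\<^sub>0"
    and "cdt_feasible A a B b \<noteq> {}"
    and "ker (stack_rows (Q\<^sub>0 - lambda_min Q\<^sub>0 *\<^sub>R mat 1) A)
           \<inter> {v. B *v v \<le> 0} \<inter> {v. q\<^sub>0 \<bullet> v \<le> 0} \<noteq> {0}"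
  shows "lagrangian_value Q\<^sub>0 q\<^sub>0 A a B b = copositive_value Q\<^sub>0 q\<^sub>0 A a B b
       \<and> copositive_value Q\<^sub>0 q\<^sub>0 A a B b = cdt_value Q\<^sub>0 q\<^sub>0 A a B b"
proof -
  define lam where "lam = lambda_min Q\<^sub>0"
  \<comment> \<open>The intersection contains 0, so differing from \<open>{0}\<close> means having a
    nonzero element.\<close>
  obtain v where v: "v \<noteq> 0" "(Q\<^sub>0 - lam *\<^sub>R mat 1) *v v = 0" "A *v v = 0" "B *v v \<le> 0" "q\<^sub>0 \<bullet> v \<le> 0"
    using assms(3) by (auto simp: ker_stack_rows lam_def)
  have Qv: "Q\<^sub>0 *v v = lam *\<^sub>R v"
    using v(2) by (simp add: matrix_vector_mult_diff_rdistrib scaleR_matrix_vector_assoc[symmetric])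
  obtain x\<^sub>0 where val: "cdt_value Q\<^sub>0 q\<^sub>0 A a B b = ereal (cdt_objective Q\<^sub>0 q\<^sub>0 x\<^sub>0)"
    and min: "\<And>y. y \<in> cdt_feasible A a B b \<Longrightarrow> cdt_objective Q\<^sub>0 q\<^sub>0 x\<^sub>0 \<le> cdt_objective Q\<^sub>0 q\<^sub>0 y"
    using cdt_value_attained[OF assms(2)] by metis
  \<comment> \<open>The least nonnegative shift that makes the quadratic form of the objective
    positive semidefinite.\<close>
  define \<sigma> where "\<sigma> = max 0 (- lam)"
  have "ereal (cdt_objective Q\<^sub>0 q\<^sub>0 x\<^sub>0) \<le> lagrangian_value Q\<^sub>0 q\<^sub>0 A a B b"
  proof (rule convex_strong_duality[OF assms(1) _ _ assms(2)])
    show "0 \<le> \<sigma>" by (simp add: \<sigma>_def)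
    show "0 \<le> z \<bullet> (Q\<^sub>0 *v z) + \<sigma> * (z \<bullet> z)" for z
    proof -
      have "0 \<le> (lam + \<sigma>) * (z \<bullet> z)" by (simp add: \<sigma>_def)
      then show ?thesis
        using lambda_min_eigenvalue(3)[OF assms(1), of z] by (simp add: lam_def[symmetric] distrib_right)
    qed
    fix x assume x: "x \<in> cdt_feasible A a B b"
    show "cdt_objective Q\<^sub>0 q\<^sub>0 x\<^sub>0 \<le> cdt_objective Q\<^sub>0 q\<^sub>0 x + \<sigma> * ((norm x)\<^sup>2 - 1)"
    proof (cases "lam \<ge> 0")
      case True
      then show ?thesis using min[OF x] by (simp add: \<sigma>_def)
    next
      case False
      obtain t where t: "0 \<le> t" "x + t *\<^sub>R v \<in> cdt_feasible A a B b" "norm (x + t *\<^sub>R v) = 1"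
        using feasible_slide_to_sphere[OF x v(1,3,4)] .
      let ?x = "x + t *\<^sub>R v"
      have "cdt_objective Q\<^sub>0 q\<^sub>0 x\<^sub>0 \<le> cdt_objective Q\<^sub>0 q\<^sub>0 ?x" using min t by blast
      also have "\<dots> = cdt_objective Q\<^sub>0 q\<^sub>0 ?x + \<sigma> * ((norm ?x)\<^sup>2 - 1)" using t by simp
      \<comment> \<open>Here \<sigma> = -\<open>lam\<close> and v is an eigenvector for
        \<open>lam\<close>, so all terms in t cancel except the linear one from
        \<open>q\<^sub>0\<close>, which is nonpositive.\<close>
      also have "\<dots> = cdt_objective Q\<^sub>0 q\<^sub>0 x + \<sigma> * ((norm x)\<^sup>2 - 1) + 2 * t * (q\<^sub>0 \<bullet> v)"
        using False symmetric_inner[OF assms(1), of v x]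
        by (simp add: cdt_objective_def power2_norm_eq_inner \<sigma>_def Qv matrix_vector_right_distrib
            matrix_vector_mult_scaleR inner_commute[of v x] algebra_simps)
      also have "\<dots> \<le> cdt_objective Q\<^sub>0 q\<^sub>0 x + \<sigma> * ((norm x)\<^sup>2 - 1)"
        using t v by (simp add: mult_nonneg_nonpos)
      finally show ?thesis .
    qed
  qed
  then have "cdt_value Q\<^sub>0 q\<^sub>0 A a B b \<le> lagrangian_value Q\<^sub>0 q\<^sub>0 A a B b" by (simp add: val)
  then show ?thesis
    using lagrangian_value_le_copositive_value copositive_value_le_cdt_value
    by (metis order_antisym order_trans)
qed

end
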